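(* For every odd prime $p$ and every integer $s\geq p+1$, there exists a finite $p$-group $G$ such that (1) $|G|=p^s$; (2) $G$ is of maximal class; (3) $|G:G^p\gamma_{p-1}(G)|=|\Omega_1(G)|$; (4) $\gamma_{p-1}(G)\nleq G^p$.
   Context: A $p$-group of order $p^s$ is of maximal class if its nilpotency class is $s-1$. $G^p$ denotes the subgroup generated by all $p$-th powers of elements of $G$. $\gamma_k(G)$ denotes the $k$-th term of the lower central series: $\gamma_1(G)=G$ and $\gamma_{k+1}(G)=[\gamma_k(G),G]$. $\Omega_1(G)$ denotes the subgroup of $G$ generated by the elements of order $p$. *)

theory Defs
  imports "HOL-Algebra.Multiplicative_Group" "HOL-Algebra.Generated_Groups"
    "HOL-Computational_Algebra.Primes"
begin

definition commutator_subgroup :: "('a, 'b) monoid_scheme \<Rightarrow> 'a set \<Rightarrow> 'a set \<Rightarrow> 'a set" where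
  "commutator_subgroup G H K =
     generate G {inv\<^bsub>G\<^esub> h \<otimes>\<^bsub>G\<^esub> inv\<^bsub>G\<^esub> k \<otimes>\<^bsub>G\<^esub> h \<otimes>\<^bsub>G\<^esub> k | h k. h \<in> H \<and> k \<in> K}"

(* Indexed from 1, so that lower_central G k is gamma_k(G); the value at 0 is a dummy. *)
fun lower_central :: "('a, 'b) monoid_scheme \<Rightarrow> nat \<Rightarrow> 'a set" where
  "lower_central G 0 = carrier G"
| "lower_central G (Suc 0) = carrier G"
| "lower_central G (Suc (Suc k)) = commutator_subgroup G (lower_central G (Suc k)) (carrier G)"

definition nilpotent :: "('a, 'b) monoid_scheme \<Rightarrow> bool" where
  "nilpotent G \<longleftrightarrow> (\<exists>c. lower_central G (Suc c) = {\<one>\<^bsub>G\<^esub>})"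

(* Meaningful for nilpotent groups only. *)
definition nilpotency_class :: "('a, 'b) monoid_scheme \<Rightarrow> nat" where
  "nilpotency_class G = (LEAST c. lower_central G (Suc c) = {\<one>\<^bsub>G\<^esub>})"

(* The class being s - 1 is written additively to avoid truncated subtraction. *)
definition maximal_class :: "nat \<Rightarrow> ('a, 'b) monoid_scheme \<Rightarrow> bool" where
  "maximal_class p G \<longleftrightarrow>
     nilpotent G \<and> (\<exists>s. order G = p ^ s \<and> nilpotency_class G + 1 = s)"

definition power_subgroup :: "('a, 'b) monoid_scheme \<Rightarrow> nat \<Rightarrow> 'a set" where
  "power_subgroup G n = generate G {x [^]\<^bsub>G\<^esub> n | x. x \<in> carrier G}"

definition Omega1 :: "nat \<Rightarrow> ('a, 'b) monoid_scheme \<Rightarrow> 'a set" where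
  "Omega1 p G = generate G {x \<in> carrier G. group.ord G x = p}"

definition subgroup_index :: "('a, 'b) monoid_scheme \<Rightarrow> 'a set \<Rightarrow> nat" where
  "subgroup_index G H = card (rcosets\<^bsub>G\<^esub> H)"

end

theory Submission
  imports "HOL-Computational_Algebra.Polynomial" "HOL-Number_Theory.Cong" "HOL-Library.Countable" Defs
begin

text \<open>
  Put \<open>n = s - 1\<close>. The ring \<open>A = \<int>[\<zeta>]/(\<zeta> - 1)\<^sup>n\<close>, with \<open>\<zeta>\<close> a primitive \<open>p\<close>-th root of unity,
  has order \<open>p\<^sup>n\<close>, and its ideals form a chain \<open>N\<^sub>k = (\<zeta> - 1)\<^sup>kA\<close>. Let \<open>G\<close> be the extension of \<open>A\<close>
  by an element \<open>t\<close> acting as multiplication by \<open>\<zeta>\<close> whose \<open>p\<close>-th power is the generator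
  \<open>(\<zeta> - 1)\<^sup>n\<^sup>-\<^sup>1\<close> of the socle of \<open>A\<close>. Commutation with \<open>t\<close> is multiplication by \<open>\<zeta> - 1\<close>, so
  \<open>\<gamma>\<^sub>k(G) = N\<^sub>k\<^sub>-\<^sub>1\<close> for \<open>k \<ge> 2\<close>. As \<open>1 + \<zeta> + \<dots> + \<zeta>\<^sup>p\<^sup>-\<^sup>1 = 0\<close>, the \<open>p\<close>-th power of an element outside \<open>A\<close>
  is a nontrivial multiple of \<open>t\<^sup>p\<close>; and \<open>p\<close> is a unit times \<open>(\<zeta> - 1)\<^sup>p\<^sup>-\<^sup>1\<close>. Hence \<open>G\<^sup>p = N\<^sub>p\<^sub>-\<^sub>1\<close>
  and \<open>\<Omega>\<^sub>1(G) = N\<^sub>n\<^sub>-\<^sub>p\<^sub>+\<^sub>1\<close> has order \<open>p\<^sup>p\<^sup>-\<^sup>1\<close>, the index of \<open>N\<^sub>p\<^sub>-\<^sub>2 = \<gamma>\<^sub>p\<^sub>-\<^sub>1(G)\<close>.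
\<close>

section \<open>The cyclotomic polynomial in the variable \<zeta> - 1\<close>

definition X :: "int poly" where "X = [:0, 1:]"

text \<open>The minimal polynomial of \<open>\<zeta> - 1\<close>.\<close>

definition cyclotomic_shift :: "nat \<Rightarrow> int poly" where
  "cyclotomic_shift p = (\<Sum>k<p. (1 + X) ^ k)"

lemma poly_X_0 [simp]: "poly X 0 = 0"
  by (simp add: X_def)

lemma X_nonzero [simp]: "X \<noteq> 0"
  by (simp add: X_def)

lemma X_times_eq_pCons: "X * a = pCons 0 a"
  by (simp add: X_def)

lemma poly_const_plus_X: "\<exists>b. a = [:poly a 0:] + X * b"
  by (cases a) (auto simp: X_times_eq_pCons)

lemma X_dvd_iff: "X dvd a \<longleftrightarrow> poly a 0 = 0"
  using poly_const_plus_X[of a] by (auto simp: dvd_def)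

lemma X_times_cyclotomic_shift: "X * cyclotomic_shift p = (1 + X) ^ p - 1"
  unfolding cyclotomic_shift_def using power_diff_1_eq[of "1 + X" p] by simp

lemma poly_cyclotomic_shift_0: "poly (cyclotomic_shift p) 0 = int p"
  by (simp add: cyclotomic_shift_def poly_sum)

text \<open>Modulo \<open>p\<close>, \<open>(1 + X) ^ p - 1\<close> is \<open>X ^ p\<close>, because
  \<open>p\<close> divides the middle binomial coefficients. Comparing constant terms,
  \<open>p\<close> on the left and \<open>p * poly g 0\<close> on the right, gives the value of
  \<open>g\<close> at 0.\<close>

lemma cyclotomic_shift_Eisenstein:
  assumes "prime p"
  obtains g where "cyclotomic_shift p = X ^ (p - 1) + of_nat p * g" and "poly g 0 = 1"
proof -
  have "p \<ge> 2" using assms prime_ge_2_nat by blast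
  let ?d = "cyclotomic_shift p - X ^ (p - 1)"
  have eq: "X * ?d = [:1, 1:] ^ p - Polynomial.monom 1 p - 1"
  proof -
    have "X * X ^ (p - 1) = Polynomial.monom 1 p"
      using \<open>p \<ge> 2\<close> by (cases p) (simp_all add: X_def monom_altdef)
    then show ?thesis
      using X_times_cyclotomic_shift[of p]
      by (simp add: right_diff_distrib X_def one_pCons)
  qed
  \<comment> \<open>Multiplication by \<open>X\<close> shifts coefficients by one, so they can be
    read off from \<open>(1 + X) ^ p - X ^ p - 1\<close>: binomial coefficients below degree
    \<open>p\<close>, zero from there on.\<close>
  have "int p dvd Polynomial.coeff ?d k" for k
  proof -
    have "Polynomial.coeff ?d k = Polynomial.coeff ([:1, 1:] ^ p - Polynomial.monom 1 p - 1) (Suc k)"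
      unfolding eq[symmetric] by (simp add: X_times_eq_pCons)
    also have "int p dvd \<dots>"
    proof (cases "Suc k < p")
      case True
      then show ?thesis
        using dvd_choose_prime[of "Suc k" p] assms
        by (simp add: coeff_linear_poly_power one_pCons)
    next
      case False
      then show ?thesis
      proof (cases "Suc k = p")
        case True
        then show ?thesis by (auto simp: coeff_linear_power one_pCons)
      next
        case neq: False
        have "degree ([:1, 1::int:] ^ p) = p" by (simp add: degree_power_eq)
        with neq False have "Polynomial.coeff ([:1, 1::int:] ^ p) (Suc k) = 0" 
          by (intro coeff_eq_0) simp
        with neq show ?thesis by (simp add: one_pCons)
      qed
    qed
    finally show ?thesis .
  qed
  then have "[:int p:] dvd ?d" by (simp add: const_poly_dvd_iff)
  then obtain g where "?d = [:int p:] * g" by (auto simp: dvd_def)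
  then have g: "cyclotomic_shift p = X ^ (p - 1) + of_nat p * g"
    by (simp add: of_nat_poly algebra_simps)
  then have "poly (cyclotomic_shift p) 0 = int p * poly g 0"
    using \<open>p \<ge> 2\<close> by (simp add: of_nat_poly)
  then have "poly g 0 = 1"
    using \<open>p \<ge> 2\<close> by (simp add: poly_cyclotomic_shift_0)
  with g that show thesis by blast
qed

section \<open>The ring \<open>A\<close> as polynomials modulo an ideal\<close>

locale cyclotomic_model =
  fixes p n :: nat
  assumes prime_p: "prime p" and odd_p: "odd p" and p_le_n: "p \<le> n"
begin

lemma p_ge_3: "p \<ge> 3"
  using prime_p odd_p by (metis One_nat_def Suc_leI dvd_refl le_neq_implies_less numeral_2_eq_2 numeral_3_eq_3 prime_ge_2_nat)

text \<open>The kernel of the map onto \<open>A\<close> that sends \<open>X\<close> to \<zeta> - 1.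
  Equality in \<open>A\<close> is handled throughout as membership of a difference in
  \<open>I\<close>.\<close>

definition I :: "int poly set" where
  "I = {a * cyclotomic_shift p + b * X ^ n | a b. True}"

lemma I_zero [simp]: "0 \<in> I"
  unfolding I_def by (rule CollectI, rule exI[of _ 0], rule exI[of _ 0]) simp

lemma I_add: "a \<in> I \<Longrightarrow> b \<in> I \<Longrightarrow> a + b \<in> I"
proof -
  assume "a \<in> I" "b \<in> I"
  then obtain c d e g where "a = c * cyclotomic_shift p + d * X ^ n"
    "b = e * cyclotomic_shift p + g * X ^ n" unfolding I_def by auto
  then have "a + b = (c + e) * cyclotomic_shift p + (d + g) * X ^ n" by (simp add: algebra_simps)
  then show ?thesis unfolding I_def by blast
qed

lemma I_mult: "a \<in> I \<Longrightarrow> c * a \<in> I"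
proof -
  assume "a \<in> I"
  then obtain d e where "a = d * cyclotomic_shift p + e * X ^ n" unfolding I_def by auto
  then have "c * a = (c * d) * cyclotomic_shift p + (c * e) * X ^ n" by (simp add: algebra_simps)
  then show ?thesis unfolding I_def by blast
qed

lemma I_uminus: "a \<in> I \<Longrightarrow> - a \<in> I"
  using I_mult[of a "- 1"] by simp

lemma I_diff: "a \<in> I \<Longrightarrow> b \<in> I \<Longrightarrow> a - b \<in> I"
  using I_add[OF _ I_uminus] by fastforce

lemma I_add_cancel: "b \<in> I \<Longrightarrow> a + b \<in> I \<longleftrightarrow> a \<in> I"
  using I_add[of a b] I_diff[of "a + b" b] by auto

lemma cyclotomic_shift_in_I: "cyclotomic_shift p * a \<in> I"
  unfolding I_def by (rule CollectI, rule exI[of _ a], rule exI[of _ 0]) simp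

lemma X_power_in_I: "n \<le> k \<Longrightarrow> X ^ k * a \<in> I"
  unfolding I_def
  by (rule CollectI, rule exI[of _ 0], rule exI[of _ "a * X ^ (k - n)"]) (simp flip: power_add)

text \<open>The annihilator of \<open>X ^ k\<close> in \<open>A\<close> is generated by
  \<open>X ^ (n - k)\<close>. One factor \<open>X\<close> is cancelled at a time: evaluation at 0
  gives \<open>poly c 0 * p = 0\<close>, so \<open>X\<close> divides \<open>c\<close> as
  well.\<close>

lemma X_power_cancel:
  assumes "k \<le> n" "X ^ k * a \<in> I"
  shows "\<exists>c b. a = c * cyclotomic_shift p + X ^ (n - k) * b"
  using assms
proof (induction k arbitrary: a)
  case 0
  then show ?case unfolding I_def by (auto simp: mult.commute)
next
  case (Suc k)
  have "X ^ k * (X * a) \<in> I" using Suc.prems by (simp add: mult.assoc mult.left_commute)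
  then obtain c b where cb: "X * a = c * cyclotomic_shift p + X ^ (n - k) * b"
    using Suc.IH[of "X * a"] Suc.prems by auto
  have nk: "n - k = Suc (n - Suc k)" using Suc.prems by simp
  have "poly c 0 * int p = 0"
    using arg_cong[OF cb, of "\<lambda>q. poly q 0"] nk by (simp add: poly_cyclotomic_shift_0)
  then have "poly c 0 = 0" using p_ge_3 by simp
  then obtain c' where "c = X * c'" by (auto simp flip: X_dvd_iff elim: dvdE)
  then have "X * a = X * (c' * cyclotomic_shift p + X ^ (n - Suc k) * b)"
    using cb nk by (simp add: algebra_simps)
  then show ?case by (metis X_nonzero mult_left_cancel)
qed

text \<open>After cancelling \<open>X ^ k\<close>, a positive power of \<open>X\<close> remains in
  the second generator, so the constant term comes from a multiple of
  \<open>cyclotomic_shift p\<close>, whose own constant term is \<open>p\<close>. This keeps the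
  layers of the ideal chain from collapsing.\<close>

lemma const_dvd_of_X_power_in_I:
  assumes "k < n" "X ^ k * ([:c:] + X * b) \<in> I"
  shows "int p dvd c"
proof -
  obtain e g where eg: "[:c:] + X * b = e * cyclotomic_shift p + X ^ (n - k) * g"
    using X_power_cancel assms by (meson less_imp_le)
  have "c = poly e 0 * int p"
    using arg_cong[OF eg, of "\<lambda>q. poly q 0"] assms(1) by (simp add: poly_cyclotomic_shift_0 zero_power)
  then show ?thesis by simp
qed

text \<open>Modulo \<open>I\<close>, the prime \<open>p\<close> is a unit multiple of \<open>X ^ (p - 1)\<close>.\<close>

lemma p_associated_X_power:
  obtains g h where "\<And>a. X ^ (p - 1) * a + of_nat p * (g * a) \<in> I"
    and "\<And>a. of_nat p * a + X ^ (p - 1) * (h * a) \<in> I"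
proof -
  obtain g where g: "cyclotomic_shift p = X ^ (p - 1) + of_nat p * g" "poly g 0 = 1"
    using cyclotomic_shift_Eisenstein[OF prime_p] .
  obtain b where b: "g = 1 + X * b" using poly_const_plus_X[of g] g(2) by (auto simp: one_pCons)
  \<comment> \<open>The truncated geometric series inverts \<open>g = 1 + X * b\<close> modulo
    \<open>X ^ n\<close>.\<close>
  define h where "h = (\<Sum>k<n. (- (X * b)) ^ k)"
  have gh: "g * h = 1 - X ^ n * (- b) ^ n"
    using one_diff_power_eq[of "- (X * b)" n] unfolding b h_def
    by (simp flip: power_mult_distrib)
  have 1: "X ^ (p - 1) * a + of_nat p * (g * a) \<in> I" for a
    using cyclotomic_shift_in_I[of a] unfolding g by (simp add: algebra_simps)
  have 2: "of_nat p * a + X ^ (p - 1) * (h * a) \<in> I" for a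
  proof -
    have *: "of_nat p * a = of_nat p * (g * h * a) + X ^ n * ((- b) ^ n * of_nat p * a)"
      unfolding gh by (simp add: algebra_simps)
    have "of_nat p * (g * h * a) + X ^ (p - 1) * (h * a) \<in> I"
      using 1[of "h * a"] by (simp add: algebra_simps)
    then have "of_nat p * (g * h * a) + X ^ (p - 1) * (h * a)
        + X ^ n * ((- b) ^ n * of_nat p * a) \<in> I"
      using X_power_in_I[OF order_refl] by (rule I_add)
    with * show ?thesis by (simp only: add.assoc add.commute add.left_commute)
  qed
  from 1 2 that show thesis by blast
qed

text \<open>Associated elements of \<open>A\<close> have the same annihilator.\<close>

lemma p_mult_in_I_iff: "of_nat p * a \<in> I \<longleftrightarrow> X ^ (p - 1) * a \<in> I"
proof -
  obtain g h where gh: "\<And>a. X ^ (p - 1) * a + of_nat p * (g * a) \<in> I"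
    "\<And>a. of_nat p * a + X ^ (p - 1) * (h * a) \<in> I"
    using p_associated_X_power by blast
  have "of_nat p * (g * a) \<in> I" if "of_nat p * a \<in> I"
    using I_mult[OF that, of g] by (simp add: mult.left_commute)
  moreover have "X ^ (p - 1) * (h * a) \<in> I" if "X ^ (p - 1) * a \<in> I"
    using I_mult[OF that, of h] by (simp add: mult.left_commute)
  ultimately show ?thesis
    using gh(1)[of a] gh(2)[of a] I_add_cancel by blast
qed

section \<open>The unit \<open>u\<close>, standing for \<zeta>, and the socle generator
  \<open>z\<close>\<close>

definition u :: "int poly" where "u = 1 + X"

definition z :: "int poly" where "z = X ^ (n - 1)"

lemma n_pos: "n > 0" using p_ge_3 p_le_n by simp

lemma X_mult_z_in_I: "X * z * a \<in> I"
  using X_power_in_I[of n a] n_pos unfolding z_def by (simp flip: power_Suc)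

lemma u_power_minus_1: "\<exists>b. u ^ k - 1 = X * b"
proof -
  have "poly (u ^ k - 1) 0 = 0" by (simp add: u_def)
  then show ?thesis by (metis X_dvd_iff dvdE)
qed

text \<open>Multiplication by \<open>u\<close> fixes \<open>z\<close>, as it must if
  \<open>z\<close> is to be a power of the element \<open>t\<close> acting by
  \<open>u\<close>.\<close>

lemma u_power_z: "(u ^ k - 1) * z * a \<in> I"
proof -
  obtain b where "u ^ k - 1 = X * b" using u_power_minus_1 by blast
  then have "(u ^ k - 1) * z * a = X * z * (b * a)" by (simp add: algebra_simps)
  then show ?thesis by (metis X_mult_z_in_I)
qed

lemma u_power_p: "(u ^ p - 1) * a \<in> I"
  using cyclotomic_shift_in_I[of "X * a"] X_times_cyclotomic_shift[of p] unfolding u_def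
  by (metis mult.assoc mult.commute)

lemma u_power_add_mult_p: "(u ^ (i + p * k) - u ^ i) * a \<in> I"
proof (induction k)
  case (Suc k)
  have "(u ^ (i + p * Suc k) - u ^ i) * a
    = (u ^ p - 1) * (u ^ (i + p * k) * a) + (u ^ (i + p * k) - u ^ i) * a"
    by (simp add: power_add algebra_simps)
  then show ?case using I_add[OF u_power_p Suc.IH] by metis
qed simp

lemma u_power_cong:
  assumes "int i = int j + int p * q"
  shows "(u ^ i - u ^ j) * a \<in> I"
proof (cases "q \<ge> 0")
  case True
  then have "i = j + p * nat q" using assms
    by (metis int_nat_eq nat_int_comparison(1) of_nat_add of_nat_mult)
  then show ?thesis using u_power_add_mult_p by metis
next
  case False
  then have "int j = int (i + p * nat (- q))" using assms by (simp add: algebra_simps)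
  then have "j = i + p * nat (- q)" by (simp only: of_nat_eq_iff)
  then have "(u ^ j - u ^ i) * a \<in> I" using u_power_add_mult_p by metis
  from I_uminus[OF this] show ?thesis by (simp add: algebra_simps)
qed

text \<open>As \<open>i\<close> is invertible modulo \<open>p\<close>, multiplication by
  \<open>i\<close> permutes the exponents modulo \<open>p\<close>, and the sum becomes
  \<open>cyclotomic_shift p\<close>.\<close>

lemma u_power_sum_in_I:
  assumes "\<not> p dvd i"
  shows "(\<Sum>k<p. u ^ (i * k)) * a \<in> I"
proof -
  have cop: "coprime i p" using assms prime_p by (metis coprime_commute prime_imp_coprime)
  have "inj_on (\<lambda>k. (i * k) mod p) {..<p}"
  proof (rule inj_onI)
    fix x y assume *: "x \<in> {..<p}" "y \<in> {..<p}" "i * x mod p = i * y mod p"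
    then have "[x = y] (mod p)" using cong_mult_lcancel_nat[OF cop] by (simp add: cong_def)
    then show "x = y" using * by (simp add: cong_def)
  qed
  then have "bij_betw (\<lambda>k. (i * k) mod p) {..<p} {..<p}"
    using p_ge_3 by (intro bij_betw_imageI endo_inj_surj) auto
  then have "(\<Sum>k<p. u ^ ((i * k) mod p)) = cyclotomic_shift p"
    unfolding cyclotomic_shift_def u_def by (rule sum.reindex_bij_betw)
  moreover have "(\<Sum>k\<in>K. u ^ (i * k)) * a - (\<Sum>k\<in>K. u ^ ((i * k) mod p)) * a \<in> I"
    if "finite K" for K
    using that
  proof (induction K rule: finite_induct)
    case (insert k K)
    have "(u ^ (i * k) - u ^ (i * k mod p)) * a \<in> I"
      using u_power_add_mult_p[of "i * k mod p" "i * k div p" a] by simp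
    from I_add[OF insert.IH this] insert.hyps show ?case by (simp add: algebra_simps)
  qed simp
  from this[of "{..<p}"] calculation show ?thesis
    using I_add[OF _ cyclotomic_shift_in_I[of a]] by fastforce
qed

section \<open>The extension of \<open>A\<close> by \<open>t\<close> as a group on natural
  numbers\<close>

text \<open>
  A pair \<open>(i, a)\<close> stands for \<open>t\<^sup>i a\<close>; pairs multiply as in the semidirect product, and
  \<open>eqv\<close> is the congruence generated by \<open>t\<^sup>p = z\<close> and \<open>I\<close>. A class is coded by the least natural
  number that decodes to one of its members, which makes the carrier a set of naturals.
\<close>

definition eqv :: "nat \<Rightarrow> int poly \<Rightarrow> nat \<Rightarrow> int poly \<Rightarrow> bool" where
  "eqv i a j b \<longleftrightarrow> (\<exists>q. int i = int j + int p * q \<and> a + of_int q * z - b \<in> I)"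

lemma eqv_refl: "eqv i a i a"
  unfolding eqv_def by (rule exI[of _ 0]) simp

lemma eqv_sym: "eqv i a j b \<Longrightarrow> eqv j b i a"
proof -
  assume "eqv i a j b"
  then obtain q where q: "int i = int j + int p * q" "a + of_int q * z - b \<in> I"
    unfolding eqv_def by auto
  have "b + of_int (- q) * z - a \<in> I" using I_uminus[OF q(2)] by (simp add: algebra_simps)
  then show ?thesis using q(1) unfolding eqv_def by (intro exI[of _ "- q"]) simp
qed

lemma eqv_trans: "eqv i a j b \<Longrightarrow> eqv j b k c \<Longrightarrow> eqv i a k c"
proof -
  assume "eqv i a j b" "eqv j b k c"
  then obtain q r where q: "int i = int j + int p * q" "a + of_int q * z - b \<in> I"
    and r: "int j = int k + int p * r" "b + of_int r * z - c \<in> I"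
    unfolding eqv_def by auto
  have "a + of_int (q + r) * z - c \<in> I" using I_add[OF q(2) r(2)] by (simp add: algebra_simps)
  then show ?thesis using q(1) r(1) unfolding eqv_def
    by (intro exI[of _ "q + r"]) (simp add: algebra_simps)
qed

lemma eqv_mult:
  assumes "eqv i a i' a'" "eqv j b j' b'"
  shows "eqv (i + j) (u ^ j * a + b) (i' + j') (u ^ j' * a' + b')"
proof -
  from assms obtain q r where q: "int i = int i' + int p * q" "a + of_int q * z - a' \<in> I"
    and r: "int j = int j' + int p * r" "b + of_int r * z - b' \<in> I"
    unfolding eqv_def by auto
  \<comment> \<open>The error splits into the change of exponent from \<open>j\<close> to
    \<open>j'\<close>, the two given congruences, and the trivial action of \<open>u ^ j'\<close> on
    \<open>z\<close>.\<close>
  have "u ^ j * a + b + of_int (q + r) * z - (u ^ j' * a' + b')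
    = (u ^ j - u ^ j') * a + u ^ j' * (a + of_int q * z - a') + (b + of_int r * z - b')
      - (u ^ j' - 1) * z * of_int q"
    by (simp add: algebra_simps)
  also have "\<dots> \<in> I"
    by (intro I_add I_diff I_mult q(2) r(2) u_power_z u_power_cong[OF r(1)])
  finally show ?thesis using q(1) r(1) unfolding eqv_def
    by (intro exI[of _ "q + r"]) (simp add: algebra_simps)
qed

text \<open>Countability of pairs of a number and a coefficient list makes this map onto; it is not
  injective, as \<open>Poly\<close> ignores trailing zeros.\<close>

definition decode :: "nat \<Rightarrow> nat \<times> int poly" where
  "decode m = map_prod id Poly (from_nat m :: nat \<times> int list)"

lemma decode_surj: "\<exists>m. decode m = v"
proof -
  have "decode (to_nat (fst v, coeffs (snd v))) = v" by (simp add: decode_def)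
  then show ?thesis by blast
qed

definition cls :: "nat \<Rightarrow> int poly \<Rightarrow> nat" where
  "cls i a = (LEAST m. eqv (fst (decode m)) (snd (decode m)) i a)"

lemma eqv_decode_cls: "eqv (fst (decode (cls i a))) (snd (decode (cls i a))) i a"
proof -
  obtain m where "decode m = (i, a)" using decode_surj by blast
  then have "eqv (fst (decode m)) (snd (decode m)) i a" by (simp add: eqv_refl)
  then show ?thesis unfolding cls_def by (rule LeastI)
qed

lemma cls_eq_iff: "cls i a = cls j b \<longleftrightarrow> eqv i a j b"
proof
  assume "cls i a = cls j b"
  then show "eqv i a j b" using eqv_decode_cls eqv_sym eqv_trans by metis
next
  assume "eqv i a j b"
  then have "eqv k c i a \<longleftrightarrow> eqv k c j b" for k c using eqv_sym eqv_trans by blast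
  then show "cls i a = cls j b" unfolding cls_def by simp
qed

text \<open>Moving \<open>a\<close> to the right past \<open>t ^ j\<close> multiplies it by
  \<open>u ^ j\<close>.\<close>

definition G :: "nat monoid" where
  "G = \<lparr>carrier = {cls i a | i a. True},
    monoid.mult = (\<lambda>x y. cls (fst (decode x) + fst (decode y))
      (u ^ fst (decode y) * snd (decode x) + snd (decode y))),
    one = cls 0 0\<rparr>"

lemma cls_in_carrier [simp]: "cls i a \<in> carrier G"
  unfolding G_def by auto

lemma carrierE:
  assumes "x \<in> carrier G"
  obtains i a where "x = cls i a"
  using assms unfolding G_def by auto

lemma mult_cls: "cls i a \<otimes>\<^bsub>G\<^esub> cls j b = cls (i + j) (u ^ j * a + b)"
  unfolding G_def using eqv_mult[OF eqv_decode_cls eqv_decode_cls] by (simp add: cls_eq_iff)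

lemma one_G: "\<one>\<^bsub>G\<^esub> = cls 0 0"
  by (simp add: G_def)

text \<open>Equal exponents force \<open>q = 0\<close>, so no multiple of \<open>z\<close> is
  identified with 0 and \<open>A\<close> embeds in \<open>G\<close>.\<close>

lemma cls_0_eq_iff: "cls 0 a = cls 0 b \<longleftrightarrow> a - b \<in> I"
  using p_ge_3 by (auto simp: cls_eq_iff eqv_def)

lemma cls_mult_p: "cls (p * i) a = cls 0 (a + of_nat i * z)"
  unfolding cls_eq_iff eqv_def by (rule exI[of _ "int i"]) simp

sublocale group G
proof (rule groupI)
  fix x y assume "x \<in> carrier G" "y \<in> carrier G"
  then show "x \<otimes>\<^bsub>G\<^esub> y \<in> carrier G" by (elim carrierE) (simp add: mult_cls)
next
  fix x y w assume "x \<in> carrier G" "y \<in> carrier G" "w \<in> carrier G"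
  then show "x \<otimes>\<^bsub>G\<^esub> y \<otimes>\<^bsub>G\<^esub> w = x \<otimes>\<^bsub>G\<^esub> (y \<otimes>\<^bsub>G\<^esub> w)"
    by (elim carrierE) (simp add: mult_cls power_add distrib_left mult.assoc mult.left_commute add.assoc)
next
  fix x assume "x \<in> carrier G"
  then obtain i a where x: "x = cls i a" by (rule carrierE)
  \<comment> \<open>Exponents are natural numbers, so \<open>t ^ (i * (p - 1))\<close> serves as
    inverse of \<open>t ^ i\<close>; the surplus \<open>t ^ (p * i)\<close>, which is
    \<open>i\<close> times \<open>z\<close>, is compensated in \<open>?b\<close>.\<close>
  define m where "m = i * (p - 1)"
  have "\<exists>b. cls m b \<otimes>\<^bsub>G\<^esub> x = \<one>\<^bsub>G\<^esub>"
  proof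
    let ?b = "u ^ m * (- a - of_nat i * z)"
    have m: "m + i = p * i" "i + m = p * i" unfolding m_def using p_ge_3 by (cases p; simp)+
    have "cls m ?b \<otimes>\<^bsub>G\<^esub> x = cls 0 (u ^ i * ?b + a + of_nat i * z)"
      unfolding x by (simp add: mult_cls cls_mult_p m)
    also have "u ^ i * ?b = u ^ (p * i) * (- a - of_nat i * z)"
      by (simp add: m flip: mult.assoc power_add)
    also have "\<dots> + a + of_nat i * z = - ((u ^ (0 + p * i) - u ^ 0) * (a + of_nat i * z))"
      by (simp add: algebra_simps)
    also have "cls 0 \<dots> = \<one>\<^bsub>G\<^esub>"
      unfolding one_G cls_0_eq_iff using I_uminus[OF u_power_add_mult_p[of 0 i]] by simp
    finally show "cls m ?b \<otimes>\<^bsub>G\<^esub> x = \<one>\<^bsub>G\<^esub>" .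
  qed
  then show "\<exists>y\<in>carrier G. y \<otimes>\<^bsub>G\<^esub> x = \<one>\<^bsub>G\<^esub>" by auto
next
  show "\<one>\<^bsub>G\<^esub> \<in> carrier G" by (simp add: one_G)
  fix x assume "x \<in> carrier G"
  then show "\<one>\<^bsub>G\<^esub> \<otimes>\<^bsub>G\<^esub> x = x" by (elim carrierE) (simp add: one_G mult_cls)
qed

lemma inv_cls_0: "inv\<^bsub>G\<^esub> cls 0 a = cls 0 (- a)"
  by (rule inv_equality) (simp_all add: mult_cls one_G)

lemma cls_pow: "cls i a [^]\<^bsub>G\<^esub> (m::nat) = cls (m * i) ((\<Sum>k<m. u ^ (i * k)) * a)"
proof (induction m)
  case (Suc m)
  have "u ^ i * ((\<Sum>k<m. u ^ (i * k)) * a) + a = (u ^ i * (\<Sum>k<m. u ^ (i * k)) + 1) * a"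
    by (simp add: algebra_simps)
  also have "u ^ i * (\<Sum>k<m. u ^ (i * k)) + 1 = (\<Sum>k<Suc m. u ^ (i * k))"
    unfolding sum.lessThan_Suc_shift sum_distrib_left by (simp add: power_add)
  finally have "u ^ i * ((\<Sum>k<m. u ^ (i * k)) * a) + a = (\<Sum>k<Suc m. u ^ (i * k)) * a" .
  with Suc show ?case by (simp add: mult_cls add.commute del: sum.lessThan_Suc)
qed (simp add: one_G)

section \<open>The chain of ideals and the order of \<open>G\<close>\<close>

definition N :: "nat \<Rightarrow> nat set" where
  "N k = range (\<lambda>a. cls 0 (X ^ k * a))"

lemma N_subset_carrier: "N k \<subseteq> carrier G"
  by (auto simp: N_def)

lemma subgroup_N: "subgroup (N k) G"
proof (rule subgroupI)
  show "inv\<^bsub>G\<^esub> x \<in> N k" if "x \<in> N k" for x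
  proof -
    from that obtain a where "x = cls 0 (X ^ k * a)" by (auto simp: N_def)
    then have "inv\<^bsub>G\<^esub> x = cls 0 (X ^ k * (- a))" by (simp add: inv_cls_0)
    then show ?thesis unfolding N_def by blast
  qed
  show "x \<otimes>\<^bsub>G\<^esub> y \<in> N k" if "x \<in> N k" "y \<in> N k" for x y
  proof -
    from that obtain a b where "x = cls 0 (X ^ k * a)" "y = cls 0 (X ^ k * b)"
      by (auto simp: N_def)
    then have "x \<otimes>\<^bsub>G\<^esub> y = cls 0 (X ^ k * (a + b))" by (simp add: mult_cls algebra_simps)
    then show ?thesis unfolding N_def by blast
  qed
qed (auto simp: N_def)

lemma N_antimono: "k \<le> l \<Longrightarrow> N l \<subseteq> N k"
proof
  fix x assume "k \<le> l" "x \<in> N l"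
  then obtain a where "x = cls 0 (X ^ l * a)" by (auto simp: N_def)
  then have "x = cls 0 (X ^ k * (X ^ (l - k) * a))"
    using \<open>k \<le> l\<close> by (simp flip: power_add mult.assoc)
  then show "x \<in> N k" unfolding N_def by blast
qed

lemma N_eq_one: "n \<le> k \<Longrightarrow> N k = {\<one>\<^bsub>G\<^esub>}"
  using X_power_in_I subgroup.one_closed[OF subgroup_N, of k]
  unfolding N_def one_G by (auto simp: cls_0_eq_iff)

text \<open>The residues \<open>0, ..., p - 1\<close> represent \<open>N k\<close> modulo
  \<open>N (Suc k)\<close>: they stay distinct by \<open>const_dvd_of_X_power_in_I\<close>, and they
  suffice because \<open>p\<close> is a multiple of \<open>X\<close> in \<open>A\<close>.\<close>

lemma bij_betw_N_Suc:
  assumes "k < n"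
  shows "bij_betw (\<lambda>(c, x). cls 0 (X ^ k * [:int c:]) \<otimes>\<^bsub>G\<^esub> x) ({..<p} \<times> N (Suc k)) (N k)"
proof (rule bij_betw_imageI)
  show "inj_on (\<lambda>(c, x). cls 0 (X ^ k * [:int c:]) \<otimes>\<^bsub>G\<^esub> x) ({..<p} \<times> N (Suc k))"
  proof (rule inj_onI, clarify)
    fix c x d y
    assume c: "c < p" "d < p" and xy: "x \<in> N (Suc k)" "y \<in> N (Suc k)"
      and eq: "cls 0 (X ^ k * [:int c:]) \<otimes>\<^bsub>G\<^esub> x = cls 0 (X ^ k * [:int d:]) \<otimes>\<^bsub>G\<^esub> y"
    from xy obtain a b where ab: "x = cls 0 (X ^ Suc k * a)" "y = cls 0 (X ^ Suc k * b)"
      by (auto simp: N_def)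
    have "cls 0 (X ^ k * [:int c:] + X ^ Suc k * a) = cls 0 (X ^ k * [:int d:] + X ^ Suc k * b)"
      using eq unfolding ab by (simp add: mult_cls)
    then have "X ^ k * [:int c:] + X ^ Suc k * a - (X ^ k * [:int d:] + X ^ Suc k * b) \<in> I"
      unfolding cls_0_eq_iff .
    also have "X ^ k * [:int c:] + X ^ Suc k * a - (X ^ k * [:int d:] + X ^ Suc k * b)
      = X ^ k * ([:int c - int d:] + X * (a - b))"
    proof -
      have diff: "[:int c - int d:] = [:int c:] - [:int d:]" by simp
      show ?thesis unfolding diff power_Suc by (simp only: algebra_simps)
    qed
    finally have "int p dvd int c - int d"
      by (rule const_dvd_of_X_power_in_I[OF assms])
    then have "c = d" using c
      by (metis cong_iff_dvd_diff cong_int_iff cong_less_modulus_unique_nat)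
    moreover have "x = y" using eq xy N_subset_carrier unfolding \<open>c = d\<close> by (auto simp: subset_eq)
    ultimately show "c = d \<and> x = y" by simp
  qed
  show "(\<lambda>(c, x). cls 0 (X ^ k * [:int c:]) \<otimes>\<^bsub>G\<^esub> x) ` ({..<p} \<times> N (Suc k)) = N k" (is "?l = _")
  proof
    show "?l \<subseteq> N k"
    proof clarify
      fix c x assume "x \<in> N (Suc k)"
      then have "x \<in> N k" using N_antimono[of k "Suc k"] by auto
      moreover have "cls 0 (X ^ k * [:int c:]) \<in> N k" unfolding N_def by (rule rangeI)
      ultimately show "cls 0 (X ^ k * [:int c:]) \<otimes>\<^bsub>G\<^esub> x \<in> N k"
        using subgroup_N subgroup.m_closed by metis
    qed
    show "N k \<subseteq> ?l"
    proof
      fix x assume "x \<in> N k"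
      then obtain a where a: "x = cls 0 (X ^ k * a)" by (auto simp: N_def)
      obtain r b where b: "a = [:r:] + X * b" using poly_const_plus_X by blast
      obtain h where h: "\<And>a. of_nat p * a + X ^ (p - 1) * (h * a) \<in> I"
        using p_associated_X_power by metis
      define c where "c = nat (r mod int p)"
      define q where "q = r div int p"
      have c: "c < p" "int c = r - int p * q"
        using p_ge_3 by (simp_all add: c_def q_def nat_less_iff minus_mult_div_eq_mod)
      \<comment> \<open>Reducing \<open>r\<close> modulo \<open>p\<close> leaves
        \<open>p * q\<close>, which equals \<open>- X ^ (p - 1) * h * q\<close> in \<open>A\<close>;
        one factor \<open>X\<close> is split off and the rest is absorbed here.\<close>
      define b' where "b' = b - X ^ (p - 2) * h * [:q:]"
      have "p - 1 = Suc (p - 2)" using p_ge_3 by simp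
      then have X: "X ^ (p - 1) = X * X ^ (p - 2)" by (simp only: power_Suc)
      have "[:int c:] = [:r:] - of_nat p * [:q:]" by (simp add: c(2) of_nat_poly)
      then have "a - ([:int c:] + X * b') = of_nat p * [:q:] + X ^ (p - 1) * (h * [:q:])"
        unfolding b X b'_def by (simp only: algebra_simps)
      moreover have "X ^ k * a - (X ^ k * [:int c:] + X ^ Suc k * b') = X ^ k * (a - ([:int c:] + X * b'))"
        by (simp only: power_Suc algebra_simps)
      ultimately have "X ^ k * a - (X ^ k * [:int c:] + X ^ Suc k * b') \<in> I"
        using I_mult[OF h] by metis
      then have "x = cls 0 (X ^ k * [:int c:]) \<otimes>\<^bsub>G\<^esub> cls 0 (X ^ Suc k * b')"
        unfolding a mult_cls by (simp add: cls_0_eq_iff)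
      then show "x \<in> ?l" using c(1) unfolding N_def by force
    qed
  qed
qed

lemma card_N: "k \<le> n \<Longrightarrow> card (N k) = p ^ (n - k)"
proof (induction rule: inc_induct)
  case base
  then show ?case by (simp add: N_eq_one)
next
  case (step k)
  then have "card (N k) = p * card (N (Suc k))"
    using bij_betw_same_card[OF bij_betw_N_Suc[of k]] by (simp add: card_cartesian_product)
  then show ?case using step by (simp add: Suc_diff_Suc flip: power_Suc)
qed

lemma finite_N: "finite (N k)"
proof (cases "k \<le> n")
  case True
  then show ?thesis using card_N[of k] p_ge_3 by (intro card_ge_0_finite) simp
next
  case False
  then show ?thesis using N_eq_one[of k] by simp
qed

text \<open>The powers \<open>t ^ i\<close> with \<open>i < p\<close> represent the cosets of
  \<open>A\<close>, which is \<open>N 0\<close>.\<close>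

lemma bij_betw_carrier:
  "bij_betw (\<lambda>(i, x). cls i 0 \<otimes>\<^bsub>G\<^esub> x) ({..<p} \<times> N 0) (carrier G)"
proof (rule bij_betw_imageI)
  show "inj_on (\<lambda>(i, x). cls i 0 \<otimes>\<^bsub>G\<^esub> x) ({..<p} \<times> N 0)"
  proof (rule inj_onI, clarify)
    fix i x j y
    assume ij: "i < p" "j < p" and xy: "x \<in> N 0" "y \<in> N 0"
      and eq: "cls i 0 \<otimes>\<^bsub>G\<^esub> x = cls j 0 \<otimes>\<^bsub>G\<^esub> y"
    from xy obtain a b where ab: "x = cls 0 a" "y = cls 0 b" by (auto simp: N_def)
    obtain q where "int i = int j + int p * q"
      using eq unfolding ab by (auto simp: mult_cls cls_eq_iff eqv_def)
    then have "[int i = int j] (mod int p)" by (simp add: cong_def)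
    then have "i = j" using ij by (metis cong_int_iff cong_less_modulus_unique_nat)
    moreover have "x = y" using eq xy N_subset_carrier unfolding \<open>i = j\<close> by (auto simp: subset_eq)
    ultimately show "i = j \<and> x = y" by simp
  qed
  show "(\<lambda>(i, x). cls i 0 \<otimes>\<^bsub>G\<^esub> x) ` ({..<p} \<times> N 0) = carrier G" (is "?l = _")
  proof
    show "?l \<subseteq> carrier G" using N_subset_carrier by (auto simp: subset_eq)
    show "carrier G \<subseteq> ?l"
    proof
      fix x assume "x \<in> carrier G"
      then obtain i a where x: "x = cls i a" by (rule carrierE)
      have "eqv i a (i mod p) (a + of_nat (i div p) * z)"
        unfolding eqv_def
        by (rule exI[of _ "int (i div p)"]) (simp flip: of_nat_mult of_nat_add)
      then have "x = cls (i mod p) 0 \<otimes>\<^bsub>G\<^esub> cls 0 (a + of_nat (i div p) * z)"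
        unfolding x by (simp add: mult_cls cls_eq_iff)
      moreover have "i mod p < p" using p_ge_3 by simp
      ultimately show "x \<in> ?l" unfolding N_def by force
    qed
  qed
qed

lemma order_G: "order G = p ^ Suc n"
  using bij_betw_same_card[OF bij_betw_carrier] by (simp add: order_def card_cartesian_product card_N)

lemma finite_G: "finite (carrier G)"
  using order_G p_ge_3 unfolding order_def by (intro card_ge_0_finite) simp

section \<open>Commutators and the lower central series\<close>

lemma commutator_eqI:
  assumes "x \<in> carrier G" "y \<in> carrier G" "c \<in> carrier G" "x \<otimes>\<^bsub>G\<^esub> y = y \<otimes>\<^bsub>G\<^esub> x \<otimes>\<^bsub>G\<^esub> c"
  shows "inv\<^bsub>G\<^esub> x \<otimes>\<^bsub>G\<^esub> inv\<^bsub>G\<^esub> y \<otimes>\<^bsub>G\<^esub> x \<otimes>\<^bsub>G\<^esub> y = c"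
proof -
  have "inv\<^bsub>G\<^esub> x \<otimes>\<^bsub>G\<^esub> inv\<^bsub>G\<^esub> y \<otimes>\<^bsub>G\<^esub> x \<otimes>\<^bsub>G\<^esub> y = inv\<^bsub>G\<^esub> (y \<otimes>\<^bsub>G\<^esub> x) \<otimes>\<^bsub>G\<^esub> (x \<otimes>\<^bsub>G\<^esub> y)"
    using assms by (simp add: inv_mult_group m_assoc)
  also have "\<dots> = c" using assms by (simp add: m_assoc inv_solve_left')
  finally show ?thesis .
qed

text \<open>Both products carry the exponent \<open>i + j\<close>, so they differ only by an element
  of \<open>A\<close>. For \<open>i = 0\<close>, \<open>j = 1\<close>, \<open>b = 0\<close> the
  commutator is \<open>X * a\<close>.\<close>

lemma commutator_cls:
  "inv\<^bsub>G\<^esub> cls i a \<otimes>\<^bsub>G\<^esub> inv\<^bsub>G\<^esub> cls j b \<otimes>\<^bsub>G\<^esub> cls i a \<otimes>\<^bsub>G\<^esub> cls j b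
    = cls 0 ((u ^ j - 1) * a - (u ^ i - 1) * b)"
proof (rule commutator_eqI)
  have "u ^ j * a + b = u ^ i * b + a + ((u ^ j - 1) * a - (u ^ i - 1) * b)"
    by (simp add: algebra_simps)
  then show "cls i a \<otimes>\<^bsub>G\<^esub> cls j b
    = cls j b \<otimes>\<^bsub>G\<^esub> cls i a \<otimes>\<^bsub>G\<^esub> cls 0 ((u ^ j - 1) * a - (u ^ i - 1) * b)"
    by (simp add: mult_cls add.commute[of i j])
qed simp_all

text \<open>The commutators, the \<open>p\<close>-th powers and the elements of order
  \<open>p\<close> each fill a whole \<open>N k\<close>, up to the identity, so no products of
  generators need be studied.\<close>

lemma generate_eq_subgroup:
  assumes "S \<subseteq> N k" "N k \<subseteq> insert \<one>\<^bsub>G\<^esub> S"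
  shows "generate G S = N k"
proof
  show "generate G S \<subseteq> N k" using assms(1) subgroup_N by (rule generate_subgroup_incl)
  show "N k \<subseteq> generate G S" using assms(2) generate.incl[of _ S G] generate.one[of G S] by blast
qed

text \<open>The disjunction covers both the first step, where \<open>H\<close> is all of
  \<open>G\<close> and \<open>k = 0\<close>, and the later ones inside \<open>A\<close>. Every
  \<open>u ^ j - 1\<close> is a multiple of \<open>X\<close>, which gives one inclusion.\<close>

lemma commutator_subgroup_N:
  assumes "N k \<subseteq> H" "H \<subseteq> carrier G" "k = 0 \<or> H = N k"
  shows "commutator_subgroup G H (carrier G) = N (Suc k)"
  unfolding commutator_subgroup_def
proof (rule generate_eq_subgroup)
  show "{inv\<^bsub>G\<^esub> h \<otimes>\<^bsub>G\<^esub> inv\<^bsub>G\<^esub> y \<otimes>\<^bsub>G\<^esub> h \<otimes>\<^bsub>G\<^esub> y | h y. h \<in> H \<and> y \<in> carrier G} \<subseteq> N (Suc k)"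
  proof clarify
    fix h y assume h: "h \<in> H" and y: "y \<in> carrier G"
    obtain j b where y: "y = cls j b" using y by (rule carrierE)
    obtain d where d: "u ^ j - 1 = X * d" using u_power_minus_1 by blast
    show "inv\<^bsub>G\<^esub> h \<otimes>\<^bsub>G\<^esub> inv\<^bsub>G\<^esub> y \<otimes>\<^bsub>G\<^esub> h \<otimes>\<^bsub>G\<^esub> y \<in> N (Suc k)"
    proof (cases "k = 0")
      case True
      have "h \<in> carrier G" using h assms(2) by blast
      then obtain i a where hi: "h = cls i a" by (rule carrierE)
      obtain e where e: "u ^ i - 1 = X * e" using u_power_minus_1 by blast
      have "(u ^ j - 1) * a - (u ^ i - 1) * b = X * (d * a - e * b)"
        unfolding d e by (simp add: algebra_simps)
      then show ?thesis unfolding hi y commutator_cls N_def True by auto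
    next
      case False
      then obtain a where ha: "h = cls 0 (X ^ k * a)" using h assms(3) by (auto simp: N_def)
      have "(u ^ j - 1) * (X ^ k * a) - (u ^ 0 - 1) * b = X ^ Suc k * (d * a)"
        unfolding d by (simp add: algebra_simps)
      then show ?thesis unfolding ha y commutator_cls N_def by (metis rangeI)
    qed
  qed
  show "N (Suc k) \<subseteq> insert \<one>\<^bsub>G\<^esub>
    {inv\<^bsub>G\<^esub> h \<otimes>\<^bsub>G\<^esub> inv\<^bsub>G\<^esub> y \<otimes>\<^bsub>G\<^esub> h \<otimes>\<^bsub>G\<^esub> y | h y. h \<in> H \<and> y \<in> carrier G}"
  proof
    fix x assume "x \<in> N (Suc k)"
    then obtain a where "x = cls 0 (X ^ Suc k * a)" by (auto simp: N_def)
    \<comment> \<open>Commutators with \<open>t\<close> alone already fill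
      \<open>N (Suc k)\<close>.\<close>
    also have "X ^ Suc k * a = (u ^ 1 - 1) * (X ^ k * a) - (u ^ 0 - 1) * 0"
      by (simp add: u_def)
    finally have "x = inv\<^bsub>G\<^esub> cls 0 (X ^ k * a) \<otimes>\<^bsub>G\<^esub> inv\<^bsub>G\<^esub> cls 1 0
        \<otimes>\<^bsub>G\<^esub> cls 0 (X ^ k * a) \<otimes>\<^bsub>G\<^esub> cls 1 0"
      by (simp only: commutator_cls)
    moreover have "cls 0 (X ^ k * a) \<in> H" using assms(1) by (auto simp: N_def)
    ultimately show "x \<in> insert \<one>\<^bsub>G\<^esub>
      {inv\<^bsub>G\<^esub> h \<otimes>\<^bsub>G\<^esub> inv\<^bsub>G\<^esub> y \<otimes>\<^bsub>G\<^esub> h \<otimes>\<^bsub>G\<^esub> y | h y. h \<in> H \<and> y \<in> carrier G}"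
      using cls_in_carrier by blast
  qed
qed

lemma lower_central_G: "lower_central G (Suc (Suc k)) = N (Suc k)"
proof (induction k)
  case 0
  then show ?case using commutator_subgroup_N[of 0 "carrier G"] N_subset_carrier by simp
next
  case (Suc k)
  then show ?case using commutator_subgroup_N[of "Suc k" "N (Suc k)"] N_subset_carrier by simp
qed

lemma lower_central_trivial_iff: "lower_central G (Suc c) = {\<one>\<^bsub>G\<^esub>} \<longleftrightarrow> n \<le> c"
proof (cases c)
  case 0
  \<comment> \<open>The first term of the series is \<open>G\<close> itself, which lies outside the
    chain \<open>N\<close>.\<close>
  have "card (carrier G) \<noteq> 1" using order_G p_ge_3 by (simp add: order_def)
  then have "carrier G \<noteq> {\<one>\<^bsub>G\<^esub>}" by force
  then show ?thesis using 0 n_pos by simp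
next
  case (Suc k)
  have *: "N c \<noteq> {\<one>\<^bsub>G\<^esub>}" if "c < n"
  proof
    assume "N c = {\<one>\<^bsub>G\<^esub>}"
    then have "p ^ (n - c) = 1" using card_N[of c] that by simp
    then show False using p_ge_3 that by simp
  qed
  have "lower_central G (Suc c) = N c" using Suc lower_central_G[of k] by simp
  then show ?thesis using N_eq_one[of c] * by (metis not_le)
qed

lemma maximal_class_G: "maximal_class p G"
proof -
  have "nilpotency_class G = n"
    unfolding nilpotency_class_def lower_central_trivial_iff by (rule Least_equality) auto
  then show ?thesis
    unfolding maximal_class_def nilpotent_def lower_central_trivial_iff using order_G by auto
qed

section \<open>The subgroups \<open>G^p\<close> and \<open>\<Omega>\<^sub>1(G)\<close>\<close>

lemma cls_pow_p:
  "cls i a [^]\<^bsub>G\<^esub> p = (if p dvd i then cls 0 (of_nat p * (a + of_nat (i div p) * z))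
    else cls 0 (of_nat i * z))"
proof (cases "p dvd i")
  case True
  then obtain m where m: "i = p * m" by auto
  then have "cls i a = cls 0 (a + of_nat m * z)" by (simp add: cls_mult_p)
  then have "cls i a [^]\<^bsub>G\<^esub> p = cls 0 (of_nat p * (a + of_nat m * z))" by (simp add: cls_pow)
  then show ?thesis using m p_ge_3 by simp
next
  case False
  \<comment> \<open>Outside \<open>A\<close> the conjugates of \<open>a\<close> sum to zero, and
    only \<open>t ^ (p * i)\<close> survives.\<close>
  have "cls i a [^]\<^bsub>G\<^esub> p = cls 0 ((\<Sum>k<p. u ^ (i * k)) * a + of_nat i * z)"
    by (simp add: cls_pow cls_mult_p)
  also have "\<dots> = cls 0 (of_nat i * z)"
    unfolding cls_0_eq_iff using u_power_sum_in_I[OF False, of a] by simp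
  finally show ?thesis using False by simp
qed

text \<open>Inside \<open>A\<close> the \<open>p\<close>-th powers form \<open>pA\<close>, which is
  \<open>N (p - 1)\<close>; those from outside lie in the socle \<open>N (n - 1)\<close>, contained
  in \<open>N (p - 1)\<close> by \<open>p \<le> n\<close>.\<close>

lemma power_subgroup_G: "power_subgroup G p = N (p - 1)"
  unfolding power_subgroup_def
proof (rule generate_eq_subgroup)
  obtain g h where gh: "\<And>a. X ^ (p - 1) * a + of_nat p * (g * a) \<in> I"
    "\<And>a. of_nat p * a + X ^ (p - 1) * (h * a) \<in> I"
    using p_associated_X_power by blast
  show "{x [^]\<^bsub>G\<^esub> p | x. x \<in> carrier G} \<subseteq> N (p - 1)"
  proof clarify
    fix x assume "x \<in> carrier G"
    then obtain i a where x: "x = cls i a" by (rule carrierE)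
    show "x [^]\<^bsub>G\<^esub> p \<in> N (p - 1)"
    proof (cases "p dvd i")
      case True
      let ?a = "a + of_nat (i div p) * z"
      have "x [^]\<^bsub>G\<^esub> p = cls 0 (X ^ (p - 1) * (- (h * ?a)))"
        using gh(2)[of ?a] True by (simp add: x cls_pow_p cls_0_eq_iff)
      then show ?thesis unfolding N_def by blast
    next
      case False
      then have "x [^]\<^bsub>G\<^esub> p = cls 0 (X ^ (n - 1) * of_nat i)"
        by (simp add: x cls_pow_p z_def mult.commute)
      then have "x [^]\<^bsub>G\<^esub> p \<in> N (n - 1)" unfolding N_def by blast
      then show ?thesis using p_le_n by (meson N_antimono diff_le_mono subsetD)
    qed
  qed
  show "N (p - 1) \<subseteq> insert \<one>\<^bsub>G\<^esub> {x [^]\<^bsub>G\<^esub> p | x. x \<in> carrier G}"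
  proof
    fix x assume "x \<in> N (p - 1)"
    then obtain a where "x = cls 0 (X ^ (p - 1) * a)" by (auto simp: N_def)
    also have "\<dots> = cls 0 (- (g * a)) [^]\<^bsub>G\<^esub> p"
      using gh(1)[of a] by (simp add: cls_pow cls_0_eq_iff)
    finally show "x \<in> insert \<one>\<^bsub>G\<^esub> {x [^]\<^bsub>G\<^esub> p | x. x \<in> carrier G}"
      using cls_in_carrier by blast
  qed
qed

text \<open>Outside \<open>A\<close> the power is \<open>i * z\<close> with \<open>p\<close> not
  dividing \<open>i\<close>, hence nontrivial. Inside \<open>A\<close>, \<open>p\<close> has the
  annihilator of \<open>X ^ (p - 1)\<close>.\<close>

lemma pow_p_eq_one_iff:
  assumes "x \<in> carrier G"
  shows "x [^]\<^bsub>G\<^esub> p = \<one>\<^bsub>G\<^esub> \<longleftrightarrow> x \<in> N (n - (p - 1))"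
proof
  assume eq: "x [^]\<^bsub>G\<^esub> p = \<one>\<^bsub>G\<^esub>"
  obtain i a where x: "x = cls i a" using assms by (rule carrierE)
  have "p dvd i"
  proof (rule ccontr)
    assume "\<not> p dvd i"
    then have "X ^ (n - 1) * ([:int i:] + X * 0) \<in> I"
      using eq by (simp add: x cls_pow_p one_G cls_0_eq_iff z_def of_nat_poly)
    then have "int p dvd int i" by (rule const_dvd_of_X_power_in_I[rotated]) (use n_pos in simp)
    then show False using \<open>\<not> p dvd i\<close> by simp
  qed
  define b where "b = a + of_nat (i div p) * z"
  have xb: "x = cls 0 b" using \<open>p dvd i\<close> cls_mult_p[of "i div p" a] by (simp add: x b_def)
  have "X ^ (p - 1) * b \<in> I"
    using eq \<open>p dvd i\<close> by (simp add: x cls_pow_p one_G cls_0_eq_iff p_mult_in_I_iff flip: b_def)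
  then obtain c d where "b = c * cyclotomic_shift p + X ^ (n - (p - 1)) * d"
    using X_power_cancel p_le_n by (metis diff_le_self le_trans)
  then have "x = cls 0 (X ^ (n - (p - 1)) * d)"
    unfolding xb cls_0_eq_iff using cyclotomic_shift_in_I[of c] by (simp add: mult.commute)
  then show "x \<in> N (n - (p - 1))" unfolding N_def by blast
next
  assume "x \<in> N (n - (p - 1))"
  then obtain a where x: "x = cls 0 (X ^ (n - (p - 1)) * a)" by (auto simp: N_def)
  have "X ^ (p - 1) * (X ^ (n - (p - 1)) * a) = X ^ n * a"
    using p_le_n by (simp flip: power_add mult.assoc)
  then have "of_nat p * (X ^ (n - (p - 1)) * a) \<in> I"
    by (simp only: p_mult_in_I_iff X_power_in_I order_refl)
  then show "x [^]\<^bsub>G\<^esub> p = \<one>\<^bsub>G\<^esub>"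
    by (simp add: x cls_pow one_G cls_0_eq_iff)
qed

lemma ord_eq_p_iff:
  assumes "x \<in> carrier G"
  shows "ord x = p \<longleftrightarrow> x \<noteq> \<one>\<^bsub>G\<^esub> \<and> x [^]\<^bsub>G\<^esub> p = \<one>\<^bsub>G\<^esub>"
  using assms prime_p p_ge_3 pow_eq_id[OF assms, of p] ord_eq_1[OF assms]
  by (auto simp: prime_nat_iff)

lemma Omega1_G: "Omega1 p G = N (n - (p - 1))"
  unfolding Omega1_def
  by (rule generate_eq_subgroup)
    (use ord_eq_p_iff pow_p_eq_one_iff N_subset_carrier in \<open>auto simp: subset_eq\<close>)

section \<open>The index and the failure of inclusion\<close>

lemma set_mult_N:
  assumes "k \<le> l"
  shows "N l <#>\<^bsub>G\<^esub> N k = N k"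
proof
  show "N l <#>\<^bsub>G\<^esub> N k \<subseteq> N k"
    using N_antimono[OF assms] subgroup.m_closed[OF subgroup_N] by (auto simp: set_mult_def)
  show "N k \<subseteq> N l <#>\<^bsub>G\<^esub> N k"
  proof
    fix x assume "x \<in> N k"
    then have "x = \<one>\<^bsub>G\<^esub> \<otimes>\<^bsub>G\<^esub> x" by (metis N_subset_carrier l_one subsetD)
    then show "x \<in> N l <#>\<^bsub>G\<^esub> N k"
      using \<open>x \<in> N k\<close> subgroup.one_closed[OF subgroup_N] unfolding set_mult_def by blast
  qed
qed

text \<open>Oddness of \<open>p\<close> gives \<open>p - 1 \<ge> 2\<close>, so this term belongs to
  the chain \<open>N\<close>.\<close>

lemma lower_central_p_minus_1: "lower_central G (p - 1) = N (p - 2)"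
proof -
  have "p - 1 = Suc (Suc (p - 3))" "p - 2 = Suc (p - 3)" using p_ge_3 by simp_all
  then show ?thesis using lower_central_G[of "p - 3"] by simp
qed

text \<open>The product is \<open>N (p - 2)\<close>, of order \<open>p ^ (n - p + 2)\<close>, so its
  index in a group of order \<open>p ^ (n + 1)\<close> is \<open>p ^ (p - 1)\<close>.\<close>

lemma subgroup_index_G:
  "subgroup_index G (power_subgroup G p <#>\<^bsub>G\<^esub> lower_central G (p - 1)) = card (Omega1 p G)"
proof -
  have "p - 2 \<le> n" "Suc n = (p - 1) + (n - (p - 2))" using p_le_n p_ge_3 by simp_all
  then have "card (rcosets\<^bsub>G\<^esub> (N (p - 2))) * p ^ (n - (p - 2)) = p ^ (p - 1) * p ^ (n - (p - 2))"
    using lagrange[OF subgroup_N[of "p - 2"]] order_G card_N[of "p - 2"] by (metis power_add)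
  then have "card (rcosets\<^bsub>G\<^esub> (N (p - 2))) = p ^ (p - 1)" using p_ge_3 by simp
  moreover have "card (Omega1 p G) = p ^ (p - 1)"
    using p_le_n by (simp add: Omega1_G card_N)
  ultimately show ?thesis
    unfolding power_subgroup_G lower_central_p_minus_1 subgroup_index_def
    by (simp add: set_mult_N)
qed

lemma lower_central_not_subset: "\<not> lower_central G (p - 1) \<subseteq> power_subgroup G p"
proof
  assume "lower_central G (p - 1) \<subseteq> power_subgroup G p"
  then have "card (N (p - 2)) \<le> card (N (p - 1))"
    unfolding power_subgroup_G lower_central_p_minus_1 by (rule card_mono[OF finite_N])
  then have "p ^ (n - (p - 2)) \<le> p ^ (n - (p - 1))" using p_le_n by (simp add: card_N)
  then show False using p_ge_3 p_le_n by simp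
qed

end

theorem theoremC:
  fixes p s :: nat
  assumes "prime p" and "odd p" and "s \<ge> p + 1"
  shows "\<exists>G :: nat monoid. group G \<and> finite (carrier G)
    \<and> order G = p ^ s
    \<and> maximal_class p G
    \<and> subgroup_index G (power_subgroup G p <#>\<^bsub>G\<^esub> lower_central G (p - 1)) = card (Omega1 p G)
    \<and> \<not> lower_central G (p - 1) \<subseteq> power_subgroup G p"
proof -
  \<comment> \<open>Adjoining \<open>t\<close> contributes one factor \<open>p\<close> to the order,
    hence \<open>n = s - 1\<close>; the bound on \<open>s\<close> becomes
    \<open>p \<le> n\<close>.\<close>
  interpret cyclotomic_model p "s - 1"
    using assms by unfold_locales simp_all
  have "order G = p ^ s" using order_G assms(3) by simp
  then show ?thesis
    using is_group finite_G maximal_class_G subgroup_index_G lower_central_not_subset by blast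
qed

end
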